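(* Consider the Best-Fit algorithm in the random-order model restricted to inputs in which every item has size in $(1/3,1]$. Then its asymptotic random-order ratio equals $1$, i.e. $$\limsup_{m\to\infty}\ \sup_{I:\ \mathrm{Opt}(I)=m,\ \text{all sizes in }(1/3,1]}\ \frac{\mathbb E_\sigma[\mathrm{BF}(I_\sigma)]}{\mathrm{Opt}(I)}=1.$$
   Context: Bin packing: items with sizes in $(0,1]$ are to be partitioned into the minimum number $\mathrm{Opt}(I)$ of bins of total size at most $1$. Best-Fit (BF) is the online algorithm that packs each arriving item into the fullest bin (highest total size) in which it fits, opening a new bin if it fits in no open bin; $\mathrm{BF}(L)$ is the number of bins it uses on list $L$. In the random-order model, an adversary fixes the list $I=(x_1,\dots,x_n)$, $\sigma$ is drawn uniformly at random from the permutations of $[n]$, and the items arrive in the order $I_\sigma=(x_{\sigma(1)},\dots,x_{\sigma(n)})$. *)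

theory Defs
  imports "HOL-Combinatorics.Permutations" "HOL-Library.Extended_Real" "HOL-Library.Liminf_Limsup"
begin

text \<open>Bin configuration: list of bin loads (total sizes), in opening order.\<close>

definition bf_index :: "real list \<Rightarrow> real \<Rightarrow> nat" where
  "bf_index ls x = (LEAST i. i < length ls \<and> ls ! i + x \<le> 1 \<and>
      (\<forall>k<length ls. ls ! k + x \<le> 1 \<longrightarrow> ls ! k \<le> ls ! i))"

definition bf_step :: "real list \<Rightarrow> real \<Rightarrow> real list" where
  "bf_step ls x = (if \<exists>i<length ls. ls ! i + x \<le> 1
      then ls[bf_index ls x := ls ! bf_index ls x + x]
      else ls @ [x])"

definition bf_pack :: "real list \<Rightarrow> real list" where
  "bf_pack xs = fold (\<lambda>x ls. bf_step ls x) xs []"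

definition BF :: "real list \<Rightarrow> nat" where
  "BF xs = length (bf_pack xs)"

definition Opt :: "real list \<Rightarrow> nat" where
  "Opt xs = (LEAST k. \<exists>f :: nat \<Rightarrow> nat. (\<forall>i<length xs. f i < k) \<and>
      (\<forall>j<k. (\<Sum>i | i < length xs \<and> f i = j. xs ! i) \<le> 1))"

definition exp_BF :: "real list \<Rightarrow> real" where
  "exp_BF xs = (\<Sum>\<sigma> | \<sigma> permutes {..<length xs}.
       real (BF (map (\<lambda>i. xs ! \<sigma> i) [0..<length xs]))) / fact (length xs)"

end

theory Submission
  imports Defs "HOL-Real_Asymp.Real_Asymp"
begin

text \<open>
  Every bin holds at most two items. Call an item large if its size exceeds 1/2 and medium
  otherwise. Best-Fit never has two bins containing a single medium item, so with weight 2 for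
  large and 1 for medium items, twice its number of bins is, up to 1, the total weight minus the
  number of bins holding a large and a medium item. For an optimal packing the total weight
  minus the number of such mixed bins is a lower bound. Hence it suffices that Best-Fit creates,
  in expectation and up to \<open>o(n)\<close>, as many mixed bins as the optimum.

  An exchange argument shows that Best-Fit creates at least as many mixed bins as there are edges
  in any matching between large items and later, compatible medium items. To build such a
  matching, sort the \<open>k\<close> optimal mixed pairs by their medium item, cut them into \<open>T\<close> groups, and cut
  the arrival times into \<open>T\<close> intervals. A large item of group \<open>j + 1\<close> is compatible with every
  medium item of group \<open>j\<close>; match those arriving in interval \<open>t\<close> with the medium items of group \<open>j\<close>
  arriving in interval \<open>t + 1\<close>. By a second moment bound each of the \<open>(T - 1)\<^sup>2\<close> cells loses
  \<open>O(sqrt n / T)\<close> of its expected \<open>k / T\<^sup>2\<close> pairs, for a total loss of \<open>O(n / T + T sqrt n)\<close>.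
\<close>

section \<open>Matchings of medium items to earlier large items\<close>

text \<open>
  \<open>matchable A xs k\<close>: when \<open>xs\<close> arrives, \<open>k\<close> of its medium items can be put one-to-one on bins whose
  loads are in \<open>A\<close> or on large items of \<open>xs\<close> that arrived earlier.
\<close>

inductive matchable :: "real multiset \<Rightarrow> real list \<Rightarrow> nat \<Rightarrow> bool" where
  Nil: "matchable A [] 0"
| large: "1/2 < x \<Longrightarrow> matchable (add_mset x A) xs k \<Longrightarrow> matchable A (x # xs) k"
| skip: "matchable A xs k \<Longrightarrow> matchable A (x # xs) k"
| pair: "x \<le> 1/2 \<Longrightarrow> y + x \<le> 1 \<Longrightarrow> matchable A xs k \<Longrightarrow>
    matchable (add_mset y A) (x # xs) (Suc k)"

inductive_cases matchable_NilE: "matchable A [] k"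
inductive_cases matchable_ConsE [consumes 1]: "matchable A (x # xs) k"

lemma matchable_add: "matchable A xs k \<Longrightarrow> matchable (add_mset y A) xs k"
proof (induction arbitrary: y rule: matchable.induct)
  case (large x A xs k)
  show ?case using matchable.large[OF large(1)] large(3)[of y] by (simp add: add_mset_commute)
next
  case (pair x z A xs k)
  show ?case using matchable.pair[OF pair(1,2) pair(4)[of y]] by (simp add: add_mset_commute)
qed (auto intro: matchable.intros)

text \<open>Lower loads are more permissive: the medium item put on \<open>y\<close>, if there is
  one, also fits on \<open>z\<close>, so the assignment carries over.\<close>

lemma matchable_decrease:
  assumes "matchable (add_mset y A) xs k" and "z \<le> y"
  shows "matchable (add_mset z A) xs k"
  using assms
proof (induction "add_mset y A" xs k arbitrary: A rule: matchable.induct)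
  case (large x xs k)
  have "matchable (add_mset z (add_mset x A)) xs k"
    using large by (simp add: add_mset_commute)
  then show ?case using matchable.large[OF large(1)] by (simp add: add_mset_commute)
next
  case (pair x u B xs k)
  show ?case
  proof (cases "u = y")
    case True
    with pair show ?thesis by (auto intro!: matchable.pair)
  next
    case False
    with pair(5) obtain C where "A = add_mset u C" "B = add_mset y C"
      by (auto simp: add_eq_conv_ex)
    moreover from this(2) have "matchable (add_mset z C) xs k" using pair by blast
    ultimately show ?thesis
      using matchable.pair[OF pair(1,2), of "add_mset z C"] by (simp add: add_mset_commute)
  qed
qed (auto intro: matchable.intros)

text \<open>A bin takes part in at most one match, so withdrawing it costs at most one.\<close>

lemma matchable_remove:
  assumes "matchable (add_mset y A) xs k"
  shows "\<exists>k'. k \<le> Suc k' \<and> matchable A xs k'"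
  using assms
proof (induction "add_mset y A" xs k arbitrary: A rule: matchable.induct)
  case (large x xs k)
  then have "\<exists>k'. k \<le> Suc k' \<and> matchable (add_mset x A) xs k'"
    by (simp add: add_mset_commute)
  then show ?case using matchable.large[OF large(1)] by blast
next
  case (pair x u B xs k)
  show ?case
  proof (cases "u = y")
    case True
    with pair show ?thesis by (auto intro!: matchable.skip)
  next
    case False
    with pair(5) obtain C where "A = add_mset u C" "B = add_mset y C"
      by (auto simp: add_eq_conv_ex)
    moreover from pair(4)[OF this(2)] obtain k' where "k \<le> Suc k'" "matchable C xs k'" by blast
    ultimately show ?thesis using matchable.pair[OF pair(1,2), of C xs k'] by auto
  qed
qed (auto intro: matchable.intros)

section \<open>The exchange argument for Best-Fit\<close>

text \<open>The later argument looks only at the multiset of loads, where the choice among equally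
  full bins disappears. A maximum over the nonempty finite set of fitting bins shows that the
  \<open>LEAST\<close> in \<open>bf_index\<close> is attained.\<close>

lemma bf_step_fits:
  assumes "\<exists>i<length ls. ls ! i + x \<le> 1"
  obtains y A where "mset ls = add_mset y A" "mset (bf_step ls x) = add_mset (y + x) A"
    "y + x \<le> 1" "\<And>z. z \<in># mset ls \<Longrightarrow> z + x \<le> 1 \<Longrightarrow> z \<le> y"
proof -
  let ?F = "{i. i < length ls \<and> ls ! i + x \<le> 1}"
  let ?Q = "\<lambda>i. i < length ls \<and> ls ! i + x \<le> 1 \<and>
      (\<forall>k<length ls. ls ! k + x \<le> 1 \<longrightarrow> ls ! k \<le> ls ! i)"
  have "finite ?F" "?F \<noteq> {}" using assms by auto
  then have "Max ((!) ls ` ?F) \<in> (!) ls ` ?F" by (intro Max_in) auto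
  then obtain i where i: "i \<in> ?F" "ls ! i = Max ((!) ls ` ?F)" by auto
  have "ls ! k \<le> ls ! i" if "k \<in> ?F" for k
    unfolding i(2) using that by (intro Max_ge) auto
  with i(1) have "\<exists>i. ?Q i" by blast
  then have Q: "?Q (bf_index ls x)"
    unfolding bf_index_def by (rule LeastI_ex)
  let ?i = "bf_index ls x"
  have i: "?i < length ls" using Q by blast
  show ?thesis
  proof (rule that[of "ls ! ?i" "mset ls - {#ls ! ?i#}"])
    show "mset ls = add_mset (ls ! ?i) (mset ls - {#ls ! ?i#})"
      using i by simp
    show "mset (bf_step ls x) = add_mset (ls ! ?i + x) (mset ls - {#ls ! ?i#})"
      using assms i by (simp add: bf_step_def mset_update)
    show "ls ! ?i + x \<le> 1" using Q by blast
    show "z \<le> ls ! ?i" if "z \<in># mset ls" "z + x \<le> 1" for z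
      using Q that by (auto simp: in_set_conv_nth)
  qed
qed

definition weight :: "real \<Rightarrow> nat" where
  "weight x = (if 1/2 < x then 2 else 1)"

abbreviation heavy :: "real multiset \<Rightarrow> real multiset" where
  "heavy A \<equiv> filter_mset (\<lambda>y. 1/2 < y) A"

abbreviation light :: "real multiset \<Rightarrow> real multiset" where
  "light A \<equiv> filter_mset (\<lambda>y. y \<le> 1/2) A"

text \<open>
  Exchange step: \<open>2 * length ls - size (light (mset ls))\<close> grows by the weight of \<open>x\<close>, minus 1 if \<open>x\<close>
  completes a mixed bin, and only in that case may the number of future matches drop by 1.
  Bins with two items count as \<open>heavy\<close>, which is harmless since nothing fits on them.
\<close>

lemma bf_step_matchable:
  assumes ls: "\<forall>y\<in>#mset ls. 1/3 < y" "size (light (mset ls)) \<le> 1"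
    and x: "1/3 < x"
    and m: "matchable (heavy (mset ls)) (x # xs) k"
  shows "(\<forall>y\<in>#mset (bf_step ls x). 1/3 < y) \<and> size (light (mset (bf_step ls x))) \<le> 1 \<and>
    (\<exists>k'. matchable (heavy (mset (bf_step ls x))) xs k' \<and>
      size (light (mset ls)) + k + 2 * length (bf_step ls x)
        \<le> size (light (mset (bf_step ls x))) + k' + 2 * length ls + weight x)"
proof (cases "\<exists>i<length ls. ls ! i + x \<le> 1")
  case False
  then have ms: "mset (bf_step ls x) = add_mset x (mset ls)"
    by (auto simp: bf_step_def)
  have len: "length (bf_step ls x) = Suc (length ls)"
    using False by (simp add: bf_step_def)
  have nofit: "\<not> y + x \<le> 1" if "y \<in># mset ls" for y
    using False that by (auto simp: in_set_conv_nth)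
  show ?thesis
  proof (cases "1/2 < x")
    case True
    from m have "matchable (add_mset x (heavy (mset ls))) xs k"
      
    proof (cases rule: matchable_ConsE)
      case 2
      then show ?thesis by (rule matchable_add)
    qed (use True in auto)
    then show ?thesis
      using ls x True len by (auto simp: ms weight_def)
  next
    case False
    \<comment> \<open>A bin of load at most 1/2 would have accepted the medium \<open>x\<close>;
      this keeps the number of light bins at most 1.\<close>
    have "light (mset ls) = {#}"
    proof (rule ccontr)
      assume "light (mset ls) \<noteq> {#}"
      then obtain y where "y \<in># light (mset ls)" by (meson multiset_nonemptyE)
      then have "y \<in># mset ls" "y \<le> 1/2" by auto
      with nofit[of y] False show False by auto
    qed
    moreover from m have "matchable (heavy (mset ls)) xs k"
    proof (cases rule: matchable_ConsE)
      case (3 y A k')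
      then have "y \<in># heavy (mset ls)" by simp
      then have "y \<in># mset ls" by auto
      with 3 nofit show ?thesis by blast
    qed (use False in simp_all)
    ultimately show ?thesis
      using ls x False len by (auto simp: ms weight_def)
  qed
next
  case True
  then obtain y A where yA: "mset ls = add_mset y A" "mset (bf_step ls x) = add_mset (y + x) A"
    "y + x \<le> 1" and best: "\<And>z. z \<in># mset ls \<Longrightarrow> z + x \<le> 1 \<Longrightarrow> z \<le> y"
    by (rule bf_step_fits) blast
  have len: "length (bf_step ls x) = length ls"
    by (metis yA(1,2) size_add_mset size_mset)
  have y: "1/3 < y" using ls yA by auto
  show ?thesis
  proof (cases "1/2 < y")
    case False
    \<comment> \<open>Best-Fit chose a light bin, so no heavy bin accepts \<open>x\<close>, and the
      matching cannot have put \<open>x\<close> on one. The light bin vanishes, which costs 1. A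
      medium \<open>x\<close> pays for it with its weight 1; a large \<open>x\<close> is no longer
      available as a partner, which costs at most one match more, and its weight 2 pays for
      both.\<close>
    have m': "\<exists>k'. matchable (heavy A) xs k' \<and> k + 1 \<le> k' + weight x"
      using m
    proof (cases rule: matchable_ConsE)
      case 1
      then have "matchable (add_mset x (heavy A)) xs k" using False yA by simp
      from matchable_remove[OF this] 1 show ?thesis
        by (auto simp: weight_def)
    next
      case 2
      then show ?thesis using False yA by (auto simp: weight_def)
    next
      case (3 z B k')
      then have "z \<in># heavy (mset ls)" by simp
      then have "z \<in># mset ls" "1/2 < z" by auto
      with best[of z] 3 False show ?thesis by auto
    qed
    have "size (light A) = 0" using ls(2) False yA by simp
    then have "light A = {#}" by blast
    then have l: "light (mset ls) = {#y#}" "light (mset (bf_step ls x)) = {#}"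
      using False x y unfolding yA by auto
    have h: "heavy (mset (bf_step ls x)) = add_mset (y + x) (heavy A)"
      using x y unfolding yA by auto
    from m' obtain k' where k': "matchable (heavy A) xs k'" "k + 1 \<le> k' + weight x" by blast
    have "\<forall>y\<in>#mset (bf_step ls x). 1/3 < y" using ls(1) x y by (auto simp: yA)
    then show ?thesis
      unfolding l h len using k'(2) matchable_add[OF k'(1), of "y + x"]
      by (intro conjI exI[of _ k']) (assumption | simp)+
  next
    case True
    then have x2: "x \<le> 1/2" using yA by auto
    have m': "\<exists>k'. matchable (heavy A) xs k' \<and> k \<le> Suc k'"
      using m
    proof (cases rule: matchable_ConsE)
      case 1
      with x2 show ?thesis by simp
    next
      case 2
      then have "matchable (add_mset y (heavy A)) xs k" using True yA by simp
      from matchable_remove[OF this] show ?thesis by auto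
    next
      case (3 z B k')
      then have "z \<in># heavy (mset ls)" by simp
      then have "z \<in># mset ls" by auto
      then have zy: "z \<le> y" using best 3 by blast
      have eq: "add_mset y (heavy A) = add_mset z B" using 3 True yA by simp
      show ?thesis
      proof (cases "z = y")
        case True
        then show ?thesis using eq 3 by auto
      next
        case False
        \<comment> \<open>Best-Fit used \<open>y\<close> where the matching used \<open>z\<close>,
          and \<open>z \<le> y\<close>: the item that the matching later puts on \<open>y\<close>,
          if any, goes to \<open>z\<close> instead.\<close>
        then obtain C where "heavy A = add_mset z C" "B = add_mset y C"
          using eq by (auto simp: add_eq_conv_ex)
        then show ?thesis using matchable_decrease[OF _ zy] 3 by auto
      qed
    qed
    then obtain k' where k': "matchable (heavy A) xs k'" "k \<le> Suc k'" by blast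
    have l: "light (mset (bf_step ls x)) = light (mset ls)"
      and h: "heavy (mset (bf_step ls x)) = add_mset (y + x) (heavy A)"
      using x True unfolding yA by auto
    have "\<forall>y\<in>#mset (bf_step ls x). 1/3 < y" using ls(1) x y by (auto simp: yA)
    then show ?thesis
      unfolding l h len using ls(2) x2 k'(2) matchable_add[OF k'(1), of "y + x"]
      by (intro conjI exI[of _ k']) (assumption | simp add: weight_def)+
  qed
qed

text \<open>Telescopes the exchange step over the arrivals. The constant 1 accounts for the light
  bin that may remain at the end.\<close>

lemma bf_fold_matchable:
  assumes "\<forall>y\<in>#mset ls. 1/3 < y" "size (light (mset ls)) \<le> 1"
    and "\<forall>x\<in>set xs. 1/3 < x"
    and "matchable (heavy (mset ls)) xs k"
  shows "2 * length (fold (\<lambda>x ls. bf_step ls x) xs ls) + size (light (mset ls)) + k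
    \<le> 1 + 2 * length ls + sum_list (map weight xs)"
  using assms
proof (induction xs arbitrary: ls k)
  case Nil
  then show ?case by (auto elim: matchable_NilE)
next
  case (Cons x xs)
  have x: "1/3 < x" using Cons.prems by auto
  note step = bf_step_matchable[OF Cons.prems(1,2) x Cons.prems(4)]
  then obtain k' where k': "matchable (heavy (mset (bf_step ls x))) xs k'"
      "size (light (mset ls)) + k + 2 * length (bf_step ls x)
        \<le> size (light (mset (bf_step ls x))) + k' + 2 * length ls + weight x" by blast
  show ?case
    using Cons.IH[OF _ _ _ k'(1)] step k'(2) Cons.prems(3) by auto
qed

lemma BF_matchable:
  assumes "\<forall>x\<in>set xs. 1/3 < x" and "matchable {#} xs k"
  shows "2 * BF xs + k \<le> 1 + sum_list (map weight xs)"
  using bf_fold_matchable[of "[]" xs k] assms by (simp add: BF_def bf_pack_def)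

text \<open>Positions are scanned backwards. Just before position \<open>t\<close> arrives, the
  available loads are the large ends of the edges with \<open>fst r < t\<close> and
  \<open>t \<le> snd r\<close>, and the edges with \<open>t \<le> snd r\<close> are those still to
  be realised.\<close>

lemma matchable_of_matching:
  fixes xs :: "real list"
  assumes P: "\<And>p q. (p, q) \<in> P \<Longrightarrow>
      p < q \<and> q < length xs \<and> 1/2 < xs ! p \<and> xs ! q \<le> 1/2 \<and> xs ! p + xs ! q \<le> 1"
    and inj: "inj_on fst P" "inj_on snd P"
  shows "matchable {#} xs (card P)"
proof -
  define n where "n = length xs"
  have "P \<subseteq> {..<n} \<times> {..<n}" using P by (fastforce simp: n_def)
  then have fin: "finite P" by (rule finite_subset) simp
  have "matchable (image_mset (\<lambda>r. xs ! fst r) (mset_set {r\<in>P. fst r < t \<and> t \<le> snd r}))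
      (drop t xs) (card {r\<in>P. t \<le> snd r})" if "t \<le> n" for t
    using that
  proof (induction t rule: inc_induct)
    case base
    have "{r\<in>P. n \<le> snd r} = {}" using P by (fastforce simp: n_def)
    moreover have "{r\<in>P. fst r < n \<and> n \<le> snd r} = {}" using P by (fastforce simp: n_def)
    ultimately show ?case by (simp only: n_def) (simp add: matchable.Nil)
  next
    case (step t)
    have d: "drop t xs = xs ! t # drop (Suc t) xs"
      using step by (simp add: Cons_nth_drop_Suc n_def)
    let ?A = "\<lambda>t. {r\<in>P. fst r < t \<and> t \<le> snd r}"
    let ?K = "\<lambda>t. {r\<in>P. t \<le> snd r}"
    have fin': "finite (?A t)" "finite (?K t)" for t using fin by auto
    have le: "t \<le> j \<longleftrightarrow> j = t \<or> Suc t \<le> j" for j by auto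
    consider (L) q where "(t, q) \<in> P" | (M) p where "(p, t) \<in> P"
      | (N) "\<forall>r\<in>P. fst r \<noteq> t \<and> snd r \<noteq> t" by force
    then show ?case
    proof cases
      case L
      have nM: "snd r \<noteq> t" if "r \<in> P" for r
        using P[of "fst r" "snd r"] P[OF L] that by auto
      have u: "(t, b) \<in> P \<longleftrightarrow> b = q" for b
        using L inj_onD[OF inj(1), of "(t, b)" "(t, q)"] by auto
      have A: "?A (Suc t) = insert (t, q) (?A t)"
        using P[OF L] nM by (auto simp: less_Suc_eq le u)
      have K: "?K t = ?K (Suc t)" using nM by (auto simp: le)
      have "image_mset (\<lambda>r. xs ! fst r) (mset_set (?A (Suc t)))
          = add_mset (xs ! t) (image_mset (\<lambda>r. xs ! fst r) (mset_set (?A t)))"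
        unfolding A using fin' by simp
      then show ?thesis
        using step.IH P[OF L] unfolding d K by (intro matchable.large) auto
    next
      case M
      have nL: "fst r \<noteq> t" if "r \<in> P" for r
        using P[of "fst r" "snd r"] P[OF M] that by auto
      have u: "(a, t) \<in> P \<longleftrightarrow> a = p" for a
        using M inj_onD[OF inj(2), of "(a, t)" "(p, t)"] by auto
      have A: "?A t = insert (p, t) (?A (Suc t))"
        using P[OF M] nL by (auto simp: less_Suc_eq le u)
      have "?K t = insert (p, t) (?K (Suc t))"
        using M by (auto simp: le u)
      then have K: "card (?K t) = Suc (card (?K (Suc t)))"
        using fin' by simp
      have "image_mset (\<lambda>r. xs ! fst r) (mset_set (?A t))
          = add_mset (xs ! p) (image_mset (\<lambda>r. xs ! fst r) (mset_set (?A (Suc t))))"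
        unfolding A using fin' by simp
      then show ?thesis
        using step.IH P[OF M] unfolding d K by (auto intro: matchable.pair)
    next
      case N
      have "?A t = ?A (Suc t)" "?K t = ?K (Suc t)"
        using N by (auto simp: less_Suc_eq le)
      then show ?thesis using step.IH unfolding d by (simp only: matchable.skip)
    qed
  qed
  from this[of 0] show ?thesis by simp
qed

section \<open>Mixed bins of an optimal packing\<close>

lemma sum_three_le:
  fixes f :: "nat \<Rightarrow> real"
  assumes "finite S" "{a, b, c} \<subseteq> S" "a \<noteq> b" "a \<noteq> c" "b \<noteq> c" "\<And>i. i \<in> S \<Longrightarrow> 1/3 < f i"
  shows "1 < sum f S"
proof -
  have "f a + f b + f c = sum f {a, b, c}" using assms by simp
  also have "\<dots> \<le> sum f S"
    using assms by (intro sum_mono2) (auto dest!: assms(6))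
  finally show ?thesis using assms(2) assms(6)[of a] assms(6)[of b] assms(6)[of c] by auto
qed

text \<open>Giving each item its own bin is feasible, so the \<open>LEAST\<close> in
  \<open>Opt\<close> ranges over a nonempty set and is attained.\<close>

lemma Opt_packing:
  assumes "\<forall>x\<in>set xs. x \<le> 1"
  obtains f where "\<And>i. i < length xs \<Longrightarrow> f i < Opt xs"
    "\<And>j. j < Opt xs \<Longrightarrow> (\<Sum>i | i < length xs \<and> f i = j. xs ! i) \<le> 1"
    "Opt xs \<le> length xs"
proof -
  let ?Q = "\<lambda>k. \<exists>f :: nat \<Rightarrow> nat. (\<forall>i<length xs. f i < k) \<and>
      (\<forall>j<k. (\<Sum>i | i < length xs \<and> f i = j. xs ! i) \<le> 1)"
  have "?Q (length xs)"
  proof (rule exI[of _ "\<lambda>i. i"], safe)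
    fix j assume "j < length xs"
    then have "{i. i < length xs \<and> i = j} = {j}" by auto
    then show "(\<Sum>i | i < length xs \<and> i = j. xs ! i) \<le> 1"
      using assms \<open>j < length xs\<close> by simp
  qed
  then have "?Q (Opt xs)" and le: "Opt xs \<le> length xs"
    unfolding Opt_def by - (erule LeastI Least_le)+
  then obtain f where "\<forall>i<length xs. f i < Opt xs"
    "\<forall>j<Opt xs. (\<Sum>i | i < length xs \<and> f i = j. xs ! i) \<le> 1" by blast
  then show ?thesis using that[of f] le by simp
qed

text \<open>With at most two items per bin, a bin has weight at most 2 unless it is mixed, when it
  has weight 3. Summing over the bins charges the excess to the pairs in \<open>P\<close>.\<close>

lemma Opt_pairs:
  assumes xs: "\<forall>x\<in>set xs. 1/3 < x \<and> x \<le> 1"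
  obtains P where
    "\<And>l m. (l, m) \<in> P \<Longrightarrow>
      l < length xs \<and> m < length xs \<and> 1/2 < xs ! l \<and> xs ! m \<le> 1/2 \<and> xs ! l + xs ! m \<le> 1"
    "inj_on fst P" "inj_on snd P"
    "sum_list (map weight xs) \<le> 2 * Opt xs + card P" "length xs \<le> 2 * Opt xs"
proof -
  let ?n = "length xs"
  have "\<forall>x\<in>set xs. x \<le> 1" using xs by simp
  then obtain f where f: "\<And>i. i < ?n \<Longrightarrow> f i < Opt xs"
    "\<And>j. j < Opt xs \<Longrightarrow> (\<Sum>i | i < ?n \<and> f i = j. xs ! i) \<le> 1"
    "Opt xs \<le> ?n"
    by (rule Opt_packing) blast
  have big: "1/3 < xs ! i" if "i < ?n" for i using xs that by auto
  let ?S = "\<lambda>j. {i. i < ?n \<and> f i = j}"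
  define P where "P = {(l, m). l < ?n \<and> m < ?n \<and> f l = f m \<and> 1/2 < xs ! l \<and> xs ! m \<le> 1/2}"
  have P_sub: "P \<subseteq> {..<?n} \<times> {..<?n}" by (auto simp: P_def)
  then have finP: "finite P" by (rule finite_subset) simp
  have three: "a = b \<or> a = c \<or> b = c" if "a < ?n" "b < ?n" "c < ?n" "f b = f a" "f c = f a" for a b c
  proof (rule ccontr)
    assume "\<not> ?thesis"
    then have "1 < (\<Sum>i\<in>?S (f a). xs ! i)"
      using that big by (intro sum_three_le[of _ a b c]) auto
    with f(2)[of "f a"] f(1)[of a] that show False by auto
  qed
  have two: "xs ! a + xs ! b \<le> 1" if "a < ?n" "b < ?n" "f b = f a" "a \<noteq> b" for a b
  proof -
    have "xs ! a + xs ! b = (\<Sum>i\<in>{a, b}. xs ! i)" using that by simp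
    also have "\<dots> \<le> (\<Sum>i\<in>?S (f a). xs ! i)"
      using that by (intro sum_mono2) (auto dest!: big)
    finally show ?thesis using f(2)[of "f a"] f(1)[of a] that by auto
  qed
  have bin: "(\<Sum>i\<in>?S j. weight (xs ! i)) \<le> 2 + card {p\<in>P. f (fst p) = j} \<and> card (?S j) \<le> 2" for j
  proof (cases "\<exists>a b. a \<in> ?S j \<and> b \<in> ?S j \<and> a \<noteq> b")
    case True
    \<comment> \<open>Calling the smaller item \<open>b\<close> forces it to be medium, as two large
      items overflow a bin.\<close>
    then obtain a b where ab: "a \<in> ?S j" "b \<in> ?S j" "a \<noteq> b" "xs ! b \<le> xs ! a"
      by (metis linorder_linear)
    have S: "?S j = {a, b}" using ab three[of a b] by auto
    have "xs ! a + xs ! b \<le> 1" using two[of a b] ab by auto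
    then have b: "xs ! b \<le> 1/2" using ab(4) by simp
    have "weight (xs ! a) + weight (xs ! b) \<le> 2 + card {p\<in>P. f (fst p) = j}"
    proof (cases "1/2 < xs ! a")
      case True
      then have "(a, b) \<in> {p\<in>P. f (fst p) = j}" using ab b by (auto simp: P_def)
      then have "card {p\<in>P. f (fst p) = j} > 0" using finP by (auto simp: card_gt_0_iff)
      then show ?thesis using b by (simp add: weight_def)
    next
      case False
      then show ?thesis using b by (simp add: weight_def)
    qed
    then show ?thesis using ab(3) unfolding S by simp
  next
    case False
    then consider (empty) "?S j = {}" | (single) a where "?S j = {a}" by blast
    then show ?thesis
    proof cases
      case empty
      show ?thesis unfolding empty by simp
    next
      case single
      show ?thesis unfolding single by (simp add: weight_def)
    qed
  qed
  have W: "sum_list (map weight xs) = (\<Sum>i<?n. weight (xs ! i))"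
    by (simp add: sum_list_sum_nth atLeast0LessThan)
  have fin: "finite {..<?n}" "finite {..<Opt xs}" by auto
  have sub: "f ` {..<?n} \<subseteq> {..<Opt xs}" using f(1) by auto
  have W2: "(\<Sum>i<?n. weight (xs ! i)) = (\<Sum>j<Opt xs. \<Sum>i\<in>?S j. weight (xs ! i))"
    using sum.group[OF fin sub, of "\<lambda>i. weight (xs ! i)"] by simp
  have n2: "?n = (\<Sum>j<Opt xs. card (?S j))"
    using sum.group[OF fin sub, of "\<lambda>i. 1::nat"] by simp
  have "(\<lambda>p. f (fst p)) ` P \<subseteq> {..<Opt xs}" using P_sub f(1) by auto
  then have cP: "card P = (\<Sum>j<Opt xs. card {p\<in>P. f (fst p) = j})"
    using sum.group[OF finP fin(2), of "\<lambda>p. f (fst p)" "\<lambda>i. 1::nat"] by simp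
  show ?thesis
  proof (rule that[of P])
    show "l < ?n \<and> m < ?n \<and> 1/2 < xs ! l \<and> xs ! m \<le> 1/2 \<and> xs ! l + xs ! m \<le> 1"
      if "(l, m) \<in> P" for l m
      using that two[of l m] unfolding P_def by fastforce
    show "inj_on fst P"
    proof (rule inj_onI)
      fix r s assume rs: "r \<in> P" "s \<in> P" "fst r = fst s"
      then show "r = s" using three[of "fst r" "snd r" "snd s"]
        by (auto simp: P_def)
    qed
    show "inj_on snd P"
    proof (rule inj_onI)
      fix r s assume rs: "r \<in> P" "s \<in> P" "snd r = snd s"
      obtain a m where r: "r = (a, m)" by (cases r)
      obtain b where s: "s = (b, m)" using rs(3) r by (cases s) auto
      have am: "a < ?n \<and> m < ?n \<and> f a = f m \<and> 1/2 < xs ! a \<and> xs ! m \<le> 1/2"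
        using rs(1) unfolding r P_def by blast
      have bm: "b < ?n \<and> m < ?n \<and> f b = f m \<and> 1/2 < xs ! b"
        using rs(2) unfolding s P_def by blast
      have "m \<noteq> a" "m \<noteq> b" using am bm by auto
      then show "r = s" using three[of m a b] am bm unfolding r s by blast
    qed
    have "(\<Sum>j<Opt xs. \<Sum>i\<in>?S j. weight (xs ! i)) \<le> (\<Sum>j<Opt xs. 2 + card {p\<in>P. f (fst p) = j})"
      by (rule sum_mono) (rule conjunct1[OF bin])
    also have "\<dots> = 2 * Opt xs + card P"
      unfolding cP sum.distrib by simp
    finally show "sum_list (map weight xs) \<le> 2 * Opt xs + card P"
      unfolding W W2 .
    have "(\<Sum>j<Opt xs. card (?S j)) \<le> (\<Sum>j<Opt xs. 2)"
      by (rule sum_mono) (rule conjunct2[OF bin])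
    also have "\<dots> = 2 * Opt xs" by simp
    finally show "length xs \<le> 2 * Opt xs" by (simp only: n2[symmetric])
  qed
qed

section \<open>Moments of hit counts under a random permutation\<close>

text \<open>The uniform distribution is invariant under composition with a transposition, here one
  that fixes \<open>p\<close>.\<close>

lemma sum_permutes_swap:
  fixes h :: "nat \<Rightarrow> nat \<Rightarrow> real"
  assumes "p < n" "q < n" "r < n" "p \<noteq> q" "p \<noteq> r"
  shows "(\<Sum>\<sigma> | \<sigma> permutes {..<n}. h (\<sigma> p) (\<sigma> q)) = (\<Sum>\<sigma> | \<sigma> permutes {..<n}. h (\<sigma> p) (\<sigma> r))"
proof -
  have t: "Transposition.transpose q r permutes {..<n}"
    using assms by (intro permutes_swap_id) auto
  show ?thesis
    using sum_permutations_compose_right[OF t, of "\<lambda>\<sigma>. h (\<sigma> p) (\<sigma> q)"] assms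
    by (simp add: transpose_def)
qed

text \<open>By symmetry every position gives the same sum, and over all positions each permutation
  takes every value exactly once.\<close>

lemma sum_permutes_point:
  fixes h :: "nat \<Rightarrow> real"
  assumes "p < n"
  shows "(\<Sum>\<sigma> | \<sigma> permutes {..<n}. h (\<sigma> p)) = fact n * (\<Sum>i<n. h i) / n"
proof -
  have eq: "(\<Sum>\<sigma> | \<sigma> permutes {..<n}. h (\<sigma> q)) = (\<Sum>\<sigma> | \<sigma> permutes {..<n}. h (\<sigma> p))"
    if "q < n" for q
  proof -
    have t: "Transposition.transpose p q permutes {..<n}"
      using assms that by (intro permutes_swap_id) auto
    show ?thesis
      using sum_permutations_compose_right[OF t, of "\<lambda>\<sigma>. h (\<sigma> p)"] by simp
  qed
  have "real n * (\<Sum>\<sigma> | \<sigma> permutes {..<n}. h (\<sigma> p))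
      = (\<Sum>q<n. \<Sum>\<sigma> | \<sigma> permutes {..<n}. h (\<sigma> q))"
    using eq by simp
  also have "\<dots> = (\<Sum>\<sigma> | \<sigma> permutes {..<n}. \<Sum>q<n. h (\<sigma> q))"
    by (rule sum.swap)
  also have "\<dots> = (\<Sum>\<sigma> | \<sigma> permutes {..<n}. \<Sum>i<n. h i)"
  proof (rule sum.cong)
    fix \<sigma> assume "\<sigma> \<in> {\<sigma>. \<sigma> permutes {..<n}}"
    then show "(\<Sum>q<n. h (\<sigma> q)) = (\<Sum>i<n. h i)"
      using sum.permute[of \<sigma> "{..<n}" h] by (simp add: o_def)
  qed simp
  also have "\<dots> = fact n * (\<Sum>i<n. h i)"
    by (simp add: card_permutations)
  finally show ?thesis using assms by (simp add: field_simps)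
qed

text \<open>Sampling without replacement is negatively correlated: by symmetry all positions
  \<open>r\<close> other than \<open>p\<close> give the same sum, and as \<open>g\<close> sums to 0,
  the values at these positions add up to \<open>- g (\<sigma> p)\<close>.\<close>

lemma sum_permutes_covariance:
  fixes g :: "nat \<Rightarrow> real"
  assumes g: "(\<Sum>i<n. g i) = 0" and pq: "p < n" "q < n" "p \<noteq> q"
  shows "(\<Sum>\<sigma> | \<sigma> permutes {..<n}. g (\<sigma> p) * g (\<sigma> q)) \<le> 0"
proof -
  let ?R = "{..<n} - {p}"
  have "real (card ?R) * (\<Sum>\<sigma> | \<sigma> permutes {..<n}. g (\<sigma> p) * g (\<sigma> q))
      = (\<Sum>r\<in>?R. \<Sum>\<sigma> | \<sigma> permutes {..<n}. g (\<sigma> p) * g (\<sigma> r))"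
  proof -
    have "(\<Sum>r\<in>?R. \<Sum>\<sigma> | \<sigma> permutes {..<n}. g (\<sigma> p) * g (\<sigma> r))
      = (\<Sum>r\<in>?R. \<Sum>\<sigma> | \<sigma> permutes {..<n}. g (\<sigma> p) * g (\<sigma> q))"
      by (rule sum.cong[OF refl], rule sum_permutes_swap[where h = "\<lambda>a b. g a * g b"])
        (use pq in auto)
    then show ?thesis by simp
  qed
  also have "\<dots> = (\<Sum>\<sigma> | \<sigma> permutes {..<n}. \<Sum>r\<in>?R. g (\<sigma> p) * g (\<sigma> r))"
    by (rule sum.swap)
  also have "\<dots> = (\<Sum>\<sigma> | \<sigma> permutes {..<n}. - (g (\<sigma> p) * g (\<sigma> p)))"
  proof (intro sum.cong refl)
    fix \<sigma> assume "\<sigma> \<in> {\<sigma>. \<sigma> permutes {..<n}}"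
    then have "(\<Sum>r<n. g (\<sigma> r)) = 0"
      using sum.permute[of \<sigma> "{..<n}" g] g by (simp add: o_def)
    then have "(\<Sum>r\<in>?R. g (\<sigma> r)) = - g (\<sigma> p)"
      using pq by (simp add: sum_diff1)
    then show "(\<Sum>r\<in>?R. g (\<sigma> p) * g (\<sigma> r)) = - (g (\<sigma> p) * g (\<sigma> p))"
      by (simp add: sum_distrib_left[symmetric])
  qed
  also have "\<dots> \<le> 0" by (intro sum_nonpos) simp
  finally have "real (card ?R) * (\<Sum>\<sigma> | \<sigma> permutes {..<n}. g (\<sigma> p) * g (\<sigma> q)) \<le> 0" .
  moreover have "card ?R > 0" using pq by (auto simp: card_gt_0_iff)
  ultimately show ?thesis by (intro mult_left_le_imp_le[of "real (card ?R)" _ 0]) simp_all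
qed

text \<open>The hit count is hypergeometric with mean \<open>card C * card S / n\<close>. For
  centred indicators the off-diagonal terms are nonpositive, so the diagonal alone bounds the
  variance, and it is at most the mean.\<close>

lemma sum_permutes_hits_variance:
  assumes C: "C \<subseteq> {..<n}" and S: "S \<subseteq> {..<n}" and n: "0 < n"
  shows "(\<Sum>\<sigma> | \<sigma> permutes {..<n}. (real (card {p\<in>C. \<sigma> p \<in> S}) - real (card C) * card S / n)\<^sup>2)
    \<le> fact n * (real (card C) * card S / n)"
proof -
  define s where "s = real (card S) / n"
  define g where "g i = of_bool (i \<in> S) - s" for i
  have fC: "finite C" and fS: "finite S" using C S by (auto intro: finite_subset)
  have ind: "(\<Sum>i<n. of_bool (i \<in> S)) = real (card S)"
    using S by (simp add: of_bool_def sum.If_cases Int_absorb1)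
  have g0: "(\<Sum>i<n. g i) = 0"
    using n ind by (simp add: g_def s_def sum_subtractf)
  \<comment> \<open>An indicator equals its own square, so the summand is affine in it.\<close>
  have "(\<Sum>i<n. g i * g i) = (\<Sum>i<n. (1 - 2 * s) * of_bool (i \<in> S) + s * s)"
    by (intro sum.cong refl) (auto simp: g_def algebra_simps)
  also have "\<dots> = (1 - 2 * s) * card S + n * (s * s)"
    by (simp only: sum.distrib sum_distrib_left[symmetric] ind) simp
  also have "\<dots> = card S - s * card S" using n by (simp add: s_def field_simps)
  also have "\<dots> \<le> card S" by (simp add: s_def)
  finally have g2: "(\<Sum>i<n. g i * g i) \<le> card S" .
  have X: "real (card {p\<in>C. \<sigma> p \<in> S}) - real (card C) * card S / n = (\<Sum>p\<in>C. g (\<sigma> p))" for \<sigma>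
    using fC by (simp add: g_def s_def sum_subtractf of_bool_def sum.If_cases Int_def)
  have "(\<Sum>\<sigma> | \<sigma> permutes {..<n}. (real (card {p\<in>C. \<sigma> p \<in> S}) - real (card C) * card S / n)\<^sup>2)
     = (\<Sum>\<sigma> | \<sigma> permutes {..<n}. \<Sum>p\<in>C. \<Sum>q\<in>C. g (\<sigma> p) * g (\<sigma> q))"
    unfolding X by (simp add: power2_eq_square sum_product)
  also have "\<dots> = (\<Sum>p\<in>C. \<Sum>\<sigma> | \<sigma> permutes {..<n}. \<Sum>q\<in>C. g (\<sigma> p) * g (\<sigma> q))"
    by (rule sum.swap)
  also have "\<dots> = (\<Sum>p\<in>C. \<Sum>q\<in>C. \<Sum>\<sigma> | \<sigma> permutes {..<n}. g (\<sigma> p) * g (\<sigma> q))"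
    by (intro sum.cong refl sum.swap)
  also have "\<dots> \<le> (\<Sum>p\<in>C. fact n * card S / n)"
  proof (rule sum_mono)
    fix p assume p: "p \<in> C"
    have "(\<Sum>q\<in>C. \<Sum>\<sigma> | \<sigma> permutes {..<n}. g (\<sigma> p) * g (\<sigma> q))
      = (\<Sum>\<sigma> | \<sigma> permutes {..<n}. g (\<sigma> p) * g (\<sigma> p))
        + (\<Sum>q\<in>C-{p}. \<Sum>\<sigma> | \<sigma> permutes {..<n}. g (\<sigma> p) * g (\<sigma> q))"
      by (rule sum.remove[OF fC p])
    also have "(\<Sum>q\<in>C-{p}. \<Sum>\<sigma> | \<sigma> permutes {..<n}. g (\<sigma> p) * g (\<sigma> q)) \<le> 0"
      using C p by (intro sum_nonpos sum_permutes_covariance g0) auto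
    also have "(\<Sum>\<sigma> | \<sigma> permutes {..<n}. g (\<sigma> p) * g (\<sigma> p)) = fact n * (\<Sum>i<n. g i * g i) / n"
      using C p by (intro sum_permutes_point) auto
    also have "\<dots> \<le> fact n * card S / n"
      using g2 by (intro divide_right_mono mult_left_mono) auto
    finally show "(\<Sum>q\<in>C. \<Sum>\<sigma> | \<sigma> permutes {..<n}. g (\<sigma> p) * g (\<sigma> q)) \<le> fact n * card S / n"
      by simp
  qed
  also have "\<dots> = fact n * (real (card C) * card S / n)" by simp
  finally show ?thesis .
qed

lemma sum_permutes_hits_deviation:
  fixes c :: real
  assumes "C \<subseteq> {..<n}" "S \<subseteq> {..<n}" "0 < n" "0 < c" "real (card C) * card S / n \<le> c\<^sup>2"
  shows "(\<Sum>\<sigma> | \<sigma> permutes {..<n}. \<bar>real (card {p\<in>C. \<sigma> p \<in> S}) - real (card C) * card S / n\<bar>)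
    \<le> fact n * c"
proof -
  define d where "d \<sigma> = real (card {p\<in>C. \<sigma> p \<in> S}) - real (card C) * card S / n" for \<sigma>
  \<comment> \<open>AM-GM takes the place of Cauchy-Schwarz, so that the passage from second to
    first moments holds permutation by permutation.\<close>
  have amgm: "\<bar>d \<sigma>\<bar> \<le> ((d \<sigma>)\<^sup>2 / c + c) / 2" for \<sigma>
  proof -
    have "0 \<le> (\<bar>d \<sigma>\<bar> - c)\<^sup>2" by simp
    then have "2 * (c * \<bar>d \<sigma>\<bar>) \<le> (d \<sigma>)\<^sup>2 + c * c"
      by (simp add: power2_eq_square algebra_simps)
    then show ?thesis using assms(4) by (simp add: field_simps)
  qed
  have "(\<Sum>\<sigma> | \<sigma> permutes {..<n}. \<bar>d \<sigma>\<bar>) \<le> (\<Sum>\<sigma> | \<sigma> permutes {..<n}. ((d \<sigma>)\<^sup>2 / c + c) / 2)"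
    by (intro sum_mono amgm)
  also have "\<dots> = ((\<Sum>\<sigma> | \<sigma> permutes {..<n}. (d \<sigma>)\<^sup>2) / c + fact n * c) / 2"
    by (simp add: sum.distrib card_permutations flip: sum_divide_distrib)
  also have "\<dots> \<le> (fact n * c\<^sup>2 / c + fact n * c) / 2"
  proof -
    have "(\<Sum>\<sigma> | \<sigma> permutes {..<n}. (d \<sigma>)\<^sup>2) \<le> fact n * (real (card C) * card S / n)"
      unfolding d_def using assms by (intro sum_permutes_hits_variance)
    also have "\<dots> \<le> fact n * c\<^sup>2" using assms(5) by (intro mult_left_mono) auto
    finally show ?thesis using assms(4) by (intro divide_right_mono add_right_mono) auto
  qed
  also have "\<dots> = fact n * c" using assms(4) by (simp add: power2_eq_square)
  finally show ?thesis unfolding d_def .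
qed

section \<open>Uniting matchings of disjoint rectangles, and blocks of indices\<close>

lemma matching_of_rectangle:
  assumes "finite A" "finite B"
  shows "\<exists>Q \<subseteq> A \<times> B. inj_on fst Q \<and> inj_on snd Q \<and> card Q = min (card A) (card B)"
proof -
  obtain A' where A': "A' \<subseteq> A" "card A' = min (card A) (card B)" "finite A'"
    using obtain_subset_with_card_n[of "min (card A) (card B)" A] by auto
  obtain B' where B': "B' \<subseteq> B" "card B' = min (card A) (card B)" "finite B'"
    using obtain_subset_with_card_n[of "min (card A) (card B)" B] by auto
  obtain h where h: "bij_betw h A' B'"
    using finite_same_card_bij[OF A'(3) B'(3)] A'(2) B'(2) by auto
  let ?Q = "(\<lambda>a. (a, h a)) ` A'"
  have "?Q \<subseteq> A \<times> B" using A' B' bij_betwE[OF h] by auto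
  moreover have "inj_on fst ?Q" by (auto simp: inj_on_def)
  moreover have "inj_on snd ?Q" using bij_betw_imp_inj_on[OF h] by (auto simp: inj_on_def)
  moreover have "card ?Q = min (card A) (card B)"
    using A'(2) by (subst card_image) (auto simp: inj_on_def)
  ultimately show ?thesis by blast
qed

text \<open>Two different rectangles share no left vertex and no right vertex, so the union of their
  matchings is again a matching and the sizes add up.\<close>

lemma matching_of_rectangles:
  assumes "finite I"
    and fin: "\<And>i. i \<in> I \<Longrightarrow> finite (A i) \<and> finite (B i)"
    and A: "\<And>i j a. i \<in> I \<Longrightarrow> j \<in> I \<Longrightarrow> a \<in> A i \<Longrightarrow> a \<in> A j \<Longrightarrow> i = j"
    and B: "\<And>i j b. i \<in> I \<Longrightarrow> j \<in> I \<Longrightarrow> b \<in> B i \<Longrightarrow> b \<in> B j \<Longrightarrow> i = j"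
  obtains P where "P \<subseteq> (\<Union>i\<in>I. A i \<times> B i)" "inj_on fst P" "inj_on snd P"
    "card P = (\<Sum>i\<in>I. min (card (A i)) (card (B i)))"
proof -
  have "\<forall>i\<in>I. \<exists>Q \<subseteq> A i \<times> B i. inj_on fst Q \<and> inj_on snd Q \<and> card Q = min (card (A i)) (card (B i))"
    using matching_of_rectangle fin by blast
  then obtain Q where Q: "\<forall>i\<in>I. Q i \<subseteq> A i \<times> B i \<and> inj_on fst (Q i) \<and> inj_on snd (Q i)
      \<and> card (Q i) = min (card (A i)) (card (B i))"
    by metis
  show ?thesis
  proof (rule that[of "\<Union>i\<in>I. Q i"])
    show "(\<Union>i\<in>I. Q i) \<subseteq> (\<Union>i\<in>I. A i \<times> B i)" using Q by blast
    show "inj_on fst (\<Union>i\<in>I. Q i)"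
    proof (rule inj_onI)
      fix r s assume "r \<in> (\<Union>i\<in>I. Q i)" "s \<in> (\<Union>i\<in>I. Q i)" and eq: "fst r = fst s"
      then obtain i j where ij: "i \<in> I" "j \<in> I" "r \<in> Q i" "s \<in> Q j" by blast
      then have "fst r \<in> A i" "fst s \<in> A j" using Q by (metis mem_Times_iff subsetD)+
      with A ij eq have "i = j" by metis
      with ij eq Q show "r = s" by (metis inj_onD)
    qed
    show "inj_on snd (\<Union>i\<in>I. Q i)"
    proof (rule inj_onI)
      fix r s assume "r \<in> (\<Union>i\<in>I. Q i)" "s \<in> (\<Union>i\<in>I. Q i)" and eq: "snd r = snd s"
      then obtain i j where ij: "i \<in> I" "j \<in> I" "r \<in> Q i" "s \<in> Q j" by blast
      then have "snd r \<in> B i" "snd s \<in> B j" using Q by (metis mem_Times_iff subsetD)+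
      with B ij eq have "i = j" by metis
      with ij eq Q show "r = s" by (metis inj_onD)
    qed
    have "card (\<Union>i\<in>I. Q i) = (\<Sum>i\<in>I. card (Q i))"
    proof (rule card_UN_disjoint[OF \<open>finite I\<close>])
      show "\<forall>i\<in>I. finite (Q i)"
        using Q fin by (meson finite_SigmaI finite_subset)
      show "\<forall>i\<in>I. \<forall>j\<in>I. i \<noteq> j \<longrightarrow> Q i \<inter> Q j = {}"
        using Q A by fast
    qed
    then show "card (\<Union>i\<in>I. Q i) = (\<Sum>i\<in>I. min (card (A i)) (card (B i)))"
      using Q by simp
  qed
qed

text \<open>Used to cut both the sorted pairs and the arrival positions. All blocks have the same
  length, so a remainder at the end may stay uncovered.\<close>

definition block :: "nat \<Rightarrow> nat \<Rightarrow> nat set" where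
  "block b j = {j * b..<Suc j * b}"

lemma block_div: "i \<in> block b j \<Longrightarrow> i div b = j"
  by (auto simp: block_def mult.commute intro!: div_nat_eqI)

lemma card_block [simp]: "card (block b j) = b"
  by (simp add: block_def)

lemma finite_block [simp]: "finite (block b j)"
  by (simp add: block_def)

lemma block_less: "i \<in> block b j \<Longrightarrow> i' \<in> block b (Suc j) \<Longrightarrow> i < i'"
  by (simp add: block_def)

lemma block_subset:
  assumes "j < T" "b * T \<le> n"
  shows "block b j \<subseteq> {..<n}"
proof -
  have "Suc j * b \<le> T * b" using assms by (intro mult_le_mono1) simp
  then show ?thesis using assms(2) by (auto simp: block_def mult.commute)
qed

section \<open>Matching sorted pairs cell by cell\<close>

text \<open>Together, \<open>fits\<close> and \<open>sorted\<close> make the large item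
  \<open>l i\<close> compatible with \<open>m j\<close> for every \<open>j \<le> i\<close>; this
  lets whole groups be matched arbitrarily.\<close>

locale sorted_pairs =
  fixes xs :: "real list" and k :: nat and l m :: "nat \<Rightarrow> nat"
  assumes inj: "inj_on l {..<k}" "inj_on m {..<k}"
    and less: "\<And>i. i < k \<Longrightarrow> l i < length xs \<and> m i < length xs"
    and large: "\<And>i. i < k \<Longrightarrow> 1/2 < xs ! l i"
    and medium: "\<And>i. i < k \<Longrightarrow> xs ! m i \<le> 1/2"
    and fits: "\<And>i. i < k \<Longrightarrow> xs ! l i + xs ! m i \<le> 1"
    and sorted: "\<And>i j. i \<le> j \<Longrightarrow> j < k \<Longrightarrow> xs ! m i \<le> xs ! m j"

lemma sorted_pairs_exist:
  fixes xs :: "real list"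
  assumes P: "\<And>l m. (l, m) \<in> P \<Longrightarrow>
      l < length xs \<and> m < length xs \<and> 1/2 < xs ! l \<and> xs ! m \<le> 1/2 \<and> xs ! l + xs ! m \<le> 1"
    and inj: "inj_on fst P" "inj_on snd P"
  obtains l m where "sorted_pairs xs (card P) l m"
proof -
  have "P \<subseteq> {..<length xs} \<times> {..<length xs}" using P by fastforce
  then have "finite P" by (rule finite_subset) simp
  then obtain zs where zs: "set zs = P" "distinct zs" using finite_distinct_list by blast
  define ps where "ps = sort_key (\<lambda>r. xs ! snd r) zs"
  have ps: "set ps = P" "distinct ps" by (simp_all add: ps_def zs)
  then have len: "length ps = card P" by (metis distinct_card)
  have srt: "sorted (map (\<lambda>r. xs ! snd r) ps)" by (simp add: ps_def)
  have in_P: "ps ! i \<in> P" if "i < card P" for i using that ps len by (metis nth_mem)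
  have inj_nth: "inj_on ((!) ps) {..<card P}"
    using ps len by (auto intro!: inj_onI simp: nth_eq_iff_index_eq)
  have sub: "(!) ps ` {..<card P} \<subseteq> P" using in_P by auto
  have "sorted_pairs xs (card P) (\<lambda>i. fst (ps ! i)) (\<lambda>i. snd (ps ! i))"
  proof
    show "inj_on (\<lambda>i. fst (ps ! i)) {..<card P}"
      using comp_inj_on[OF inj_nth inj_on_subset[OF inj(1) sub]] by (simp add: o_def)
    show "inj_on (\<lambda>i. snd (ps ! i)) {..<card P}"
      using comp_inj_on[OF inj_nth inj_on_subset[OF inj(2) sub]] by (simp add: o_def)
    fix i assume "i < card P"
    then have "(fst (ps ! i), snd (ps ! i)) \<in> P" using in_P by simp
    note * = P[OF this]
    show "fst (ps ! i) < length xs \<and> snd (ps ! i) < length xs"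
      "1/2 < xs ! fst (ps ! i)" "xs ! snd (ps ! i) \<le> 1/2"
      "xs ! fst (ps ! i) + xs ! snd (ps ! i) \<le> 1" using * by auto
  next
    fix i j assume "i \<le> j" "j < card P"
    then show "xs ! snd (ps ! i) \<le> xs ! snd (ps ! j)"
      using sorted_nth_mono[OF srt, of i j] len by simp
  qed
  then show ?thesis by (rule that)
qed

context sorted_pairs
begin

text \<open>Groups are indexed by \<open>j\<close> and have size \<open>b\<close>; arrival intervals are indexed by \<open>t\<close> and have length \<open>c\<close>.\<close>

definition cell_matches :: "nat \<Rightarrow> nat \<Rightarrow> (nat \<Rightarrow> nat) \<Rightarrow> nat \<times> nat \<Rightarrow> nat" where
  "cell_matches b c \<sigma> = (\<lambda>(j, t). min (card {p\<in>block c t. \<sigma> p \<in> l ` block b (Suc j)})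
      (card {p\<in>block c (Suc t). \<sigma> p \<in> m ` block b j}))"

text \<open>Position \<open>p\<close> of \<open>permute_list \<sigma> xs\<close> holds item
  \<open>\<sigma> p\<close>. The position determines its interval and, by injectivity of
  \<open>l\<close> and \<open>m\<close>, its group, so different cells share neither large nor
  medium positions. The indices stay below \<open>T - 1\<close> because a cell also uses the blocks
  \<open>Suc j\<close> and \<open>Suc t\<close>.\<close>

lemma matchable_cells:
  assumes \<sigma>: "\<sigma> permutes {..<length xs}" and b: "b * T \<le> k" and c: "c * T \<le> length xs"
  shows "matchable {#} (permute_list \<sigma> xs) (\<Sum>i\<in>{..<T-1} \<times> {..<T-1}. cell_matches b c \<sigma> i)"
proof -
  define A where "A = (\<lambda>(j, t). {p\<in>block c t. \<sigma> p \<in> l ` block b (Suc j)})"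
  define B where "B = (\<lambda>(j, t). {p\<in>block c (Suc t). \<sigma> p \<in> m ` block b j})"
  let ?I = "{..<T-1} \<times> {..<T-1}"
  have blk: "block b j \<subseteq> {..<k}" "block c j \<subseteq> {..<length xs}" if "j < T" for j
    using block_subset that b c by blast+
  have "\<exists>P. P \<subseteq> (\<Union>i\<in>?I. A i \<times> B i) \<and> inj_on fst P \<and> inj_on snd P \<and>
      card P = (\<Sum>i\<in>?I. min (card (A i)) (card (B i)))"
  proof (rule matching_of_rectangles[of ?I A B])
    show "finite ?I" by simp
    show "finite (A i) \<and> finite (B i)" for i by (simp add: A_def B_def split: prod.split)
  next
    fix i i' a assume ii: "i \<in> ?I" "i' \<in> ?I" "a \<in> A i" "a \<in> A i'"
    obtain j t j' t' where i: "i = (j, t)" "i' = (j', t')" by (cases i, cases i')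
    obtain u u' where u: "u \<in> block b (Suc j)" "\<sigma> a = l u" "u' \<in> block b (Suc j')" "\<sigma> a = l u'"
      using ii i by (auto simp: A_def)
    have "Suc j < T" "Suc j' < T" using ii i by auto
    then have "u < k" "u' < k" using u blk(1) by auto
    then have "u = u'" using u inj(1) by (auto dest: inj_onD)
    then have "j = j'" using block_div u by (metis Suc_inject)
    moreover have "a \<in> block c t" "a \<in> block c t'" using ii i by (auto simp: A_def)
    then have "t = t'" using block_div by metis
    ultimately show "i = i'" by (simp add: i)
  next
    fix i i' a assume ii: "i \<in> ?I" "i' \<in> ?I" "a \<in> B i" "a \<in> B i'"
    obtain j t j' t' where i: "i = (j, t)" "i' = (j', t')" by (cases i, cases i')
    obtain u u' where u: "u \<in> block b j" "\<sigma> a = m u" "u' \<in> block b j'" "\<sigma> a = m u'"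
      using ii i by (auto simp: B_def)
    have "j < T" "j' < T" using ii i by auto
    then have "u < k" "u' < k" using u blk(1) by auto
    then have "u = u'" using u inj(2) by (auto dest: inj_onD)
    then have "j = j'" using block_div u by metis
    moreover have "a \<in> block c (Suc t)" "a \<in> block c (Suc t')" using ii i by (auto simp: B_def)
    then have "t = t'" using block_div by (metis Suc_inject)
    ultimately show "i = i'" by (simp add: i)
  qed blast
  then obtain P where P: "P \<subseteq> (\<Union>i\<in>?I. A i \<times> B i)" "inj_on fst P" "inj_on snd P"
      "card P = (\<Sum>i\<in>?I. min (card (A i)) (card (B i)))"
    by blast
  have "matchable {#} (permute_list \<sigma> xs) (card P)"
  proof (rule matchable_of_matching[OF _ P(2,3)])
    fix p q assume "(p, q) \<in> P"
    then obtain j t where jt: "j < T - 1" "t < T - 1" "p \<in> A (j, t)" "q \<in> B (j, t)"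
      using P(1) by blast
    then obtain u v where uv: "u \<in> block b (Suc j)" "\<sigma> p = l u" "v \<in> block b j" "\<sigma> q = m v"
      by (auto simp: A_def B_def)
    have jt': "Suc j < T" "Suc t < T" using jt by auto
    have pq: "p < q" using jt block_less by (auto simp: A_def B_def)
    have q: "q < length xs" using jt blk(2)[OF jt'(2)] by (auto simp: B_def)
    have vu: "v < u" using uv block_less by blast
    have u: "u < k" using uv blk(1)[OF jt'(1)] by auto
    have "xs ! l u + xs ! m v \<le> 1" using fits[OF u] sorted[of v u] vu u by simp
    then show "p < q \<and> q < length (permute_list \<sigma> xs) \<and> 1/2 < permute_list \<sigma> xs ! p \<and>
        permute_list \<sigma> xs ! q \<le> 1/2 \<and> permute_list \<sigma> xs ! p + permute_list \<sigma> xs ! q \<le> 1"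
      using pq q vu u large[of u] medium[of v] uv \<sigma> by (simp add: permute_list_nth)
  qed
  also have "card P = (\<Sum>i\<in>?I. cell_matches b c \<sigma> i)"
    unfolding P(4) cell_matches_def A_def B_def by (intro sum.cong) auto
  finally show ?thesis .
qed

text \<open>Both hit counts of a cell have the mean \<open>c * b / length xs\<close>. Bounding their
  minimum from below by the mean minus both absolute deviations avoids their joint
  distribution.\<close>

lemma sum_cell_matches_ge:
  fixes d :: real
  assumes n: "0 < length xs" and b: "b * T \<le> k" and c: "c * T \<le> length xs"
    and d: "0 < d" "real c * b / length xs \<le> d\<^sup>2"
    and jt: "j < T - 1" "t < T - 1"
  shows "fact (length xs) * (real c * b / length xs - 2 * d)
    \<le> (\<Sum>\<sigma> | \<sigma> permutes {..<length xs}. real (cell_matches b c \<sigma> (j, t)))"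
proof -
  let ?n = "length xs"
  let ?\<mu> = "real c * b / ?n"
  have blk: "block b i \<subseteq> {..<k}" "block c i \<subseteq> {..<?n}" if "i < T" for i
    using block_subset that b c by blast+
  have jt': "Suc j < T" "j < T" "Suc t < T" "t < T" using jt by auto
  have L: "l ` block b (Suc j) \<subseteq> {..<?n}" "card (l ` block b (Suc j)) = b"
    using blk(1)[OF jt'(1)] less inj(1)
    by (auto intro!: trans[OF card_image] elim: inj_on_subset)
  have M: "m ` block b j \<subseteq> {..<?n}" "card (m ` block b j) = b"
    using blk(1)[OF jt'(2)] less inj(2)
    by (auto intro!: trans[OF card_image] elim: inj_on_subset)
  define X where "X \<sigma> = real (card {p\<in>block c t. \<sigma> p \<in> l ` block b (Suc j)})" for \<sigma>
  define Y where "Y \<sigma> = real (card {p\<in>block c (Suc t). \<sigma> p \<in> m ` block b j})" for \<sigma>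
  have X: "(\<Sum>\<sigma> | \<sigma> permutes {..<?n}. \<bar>X \<sigma> - ?\<mu>\<bar>) \<le> fact ?n * d"
    using sum_permutes_hits_deviation[of "block c t" ?n "l ` block b (Suc j)" d] blk(2)[OF jt'(4)] n d L
    by (simp add: X_def)
  have Y: "(\<Sum>\<sigma> | \<sigma> permutes {..<?n}. \<bar>Y \<sigma> - ?\<mu>\<bar>) \<le> fact ?n * d"
    using sum_permutes_hits_deviation[of "block c (Suc t)" ?n "m ` block b j" d] blk(2)[OF jt'(3)] n d M
    by (simp add: Y_def)
  have "fact ?n * (?\<mu> - 2 * d) = fact ?n * ?\<mu> - fact ?n * d - fact ?n * d"
    by (simp add: algebra_simps)
  also have "\<dots> \<le> fact ?n * ?\<mu> - (\<Sum>\<sigma> | \<sigma> permutes {..<?n}. \<bar>X \<sigma> - ?\<mu>\<bar>)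
      - (\<Sum>\<sigma> | \<sigma> permutes {..<?n}. \<bar>Y \<sigma> - ?\<mu>\<bar>)"
    using X Y by linarith
  also have "\<dots> = (\<Sum>\<sigma> | \<sigma> permutes {..<?n}. ?\<mu> - \<bar>X \<sigma> - ?\<mu>\<bar> - \<bar>Y \<sigma> - ?\<mu>\<bar>)"
    unfolding sum_subtractf by (simp add: card_permutations)
  also have "\<dots> \<le> (\<Sum>\<sigma> | \<sigma> permutes {..<?n}. real (cell_matches b c \<sigma> (j, t)))"
  proof (rule sum_mono)
    fix \<sigma>
    have "real (cell_matches b c \<sigma> (j, t)) = min (X \<sigma>) (Y \<sigma>)"
      by (simp add: cell_matches_def X_def Y_def)
    then show "?\<mu> - \<bar>X \<sigma> - ?\<mu>\<bar> - \<bar>Y \<sigma> - ?\<mu>\<bar> \<le> real (cell_matches b c \<sigma> (j, t))"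
      by linarith
  qed
  finally show ?thesis .
qed

lemma le_length: "k \<le> length xs"
proof -
  have "card (l ` {..<k}) \<le> card {..<length xs}"
    using less by (intro card_mono) auto
  then show ?thesis using card_image[OF inj(1)] by simp
qed

end

section \<open>Summing over the cells and averaging over the permutations\<close>

lemma cell_estimate:
  fixes b c k n t :: real
  assumes "1 \<le> t" "0 < n" "0 \<le> b" "0 \<le> c" "b * t \<le> k" "k \<le> b * t + t" "c * t \<le> n" "n \<le> c * t + t"
    and "k \<le> n"
  shows "k - 2 * n / t - 2 * t - 2 * t * sqrt n \<le> (t - 1)\<^sup>2 * (c * b / n - 2 * (sqrt n / t))"
proof -
  \<comment> \<open>\<open>Q\<close> is the expected number of pairs for \<open>t * t\<close> cells.
    Rounding in \<open>b\<close> and \<open>c\<close> leaves it at least \<open>k - 2 * t\<close>,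
    and passing to \<open>(t - 1) * (t - 1)\<close> cells costs at most
    \<open>2 * Q / t\<close>.\<close>
  define Q where "Q = b * t * (c * t) / n"
  have "0 \<le> Q" using assms by (simp add: Q_def)
  have "b * t * (c * t) \<le> n * n" using assms by (intro mult_mono) auto
  then have "Q \<le> n" using assms by (simp add: Q_def divide_le_eq)
  have "b * t * (n - t) \<le> b * t * (c * t)" using assms by (intro mult_left_mono) auto
  moreover have "b * t * t \<le> n * t" using assms by (intro mult_right_mono) auto
  ultimately have "(b * t - t) * n \<le> b * t * (c * t)" by (simp add: algebra_simps)
  then have "b * t - t \<le> Q" using assms by (simp add: Q_def le_divide_eq)
  then have Qk: "k - 2 * t \<le> Q" using assms by linarith
  have "(t - 1)\<^sup>2 * (c * b / n) = Q - 2 * Q / t + Q / t\<^sup>2"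
    using assms by (simp add: Q_def field_simps power2_eq_square)
  moreover have "2 * Q / t \<le> 2 * n / t" using \<open>Q \<le> n\<close> assms by (intro divide_right_mono) auto
  moreover have "0 \<le> Q / t\<^sup>2" using \<open>0 \<le> Q\<close> by simp
  ultimately have 1: "k - 2 * t - 2 * n / t \<le> (t - 1)\<^sup>2 * (c * b / n)" using Qk by linarith
  have "(t - 1)\<^sup>2 \<le> t\<^sup>2" using assms by (intro power_mono) auto
  then have "(t - 1)\<^sup>2 * (2 * (sqrt n / t)) \<le> t\<^sup>2 * (2 * (sqrt n / t))"
    using assms by (intro mult_right_mono) auto
  also have "\<dots> = 2 * t * sqrt n" using assms by (simp add: power2_eq_square)
  finally show ?thesis using 1 by (simp add: right_diff_distrib)
qed

text \<open>Averages \<open>BF_matchable\<close> over all permutations, each with its own matching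
  from \<open>matchable_cells\<close>.\<close>

lemma (in sorted_pairs) exp_BF_le_weight:
  fixes T :: nat
  assumes xs: "\<forall>x\<in>set xs. 1/3 < x" "xs \<noteq> []" and T: "1 \<le> T"
  shows "2 * exp_BF xs \<le> 1 + real (sum_list (map weight xs))
    - (k - 2 * real (length xs) / T - 2 * real T - 2 * real T * sqrt (length xs))"
proof -
  let ?n = "length xs"
  define b where "b = k div T"
  define c where "c = ?n div T"
  define W where "W = sum_list (map weight xs)"
  \<comment> \<open>The mean of a cell is at most \<open>(n / T) * (n / T) / n\<close> with
    \<open>n = length xs\<close>, because \<open>k \<le> n\<close>; \<open>d\<close> is the square
    root of this bound.\<close>
  define d where "d = sqrt ?n / T"
  let ?I = "{..<T-1} \<times> {..<T-1}"
  have n: "0 < ?n" using xs by simp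
  have b: "b * T \<le> k" "k \<le> b * T + T"
    using dividend_less_div_times[of T k] T by (simp_all add: b_def)
  have c: "c * T \<le> ?n" "?n \<le> c * T + T"
    using dividend_less_div_times[of T ?n] T by (simp_all add: c_def)
  have bc: "real b * T \<le> k" "real k \<le> real b * T + T" "real c * T \<le> ?n" "real ?n \<le> real c * T + T"
    using b c by (simp_all flip: of_nat_mult of_nat_add)
  have d0: "0 < d" using n T by (simp add: d_def)
  have "real c * T * (real b * T) \<le> real ?n * ?n"
    using bc le_length by (intro mult_mono) auto
  then have d2: "real c * b / ?n \<le> d\<^sup>2"
    using n T by (simp add: d_def power_divide field_simps power2_eq_square)
  have BF: "2 * real (BF (map (\<lambda>i. xs ! \<sigma> i) [0..<?n])) \<le> 1 + W - (\<Sum>i\<in>?I. real (cell_matches b c \<sigma> i))"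
    if \<sigma>: "\<sigma> permutes {..<?n}" for \<sigma>
  proof -
    have ms: "mset (permute_list \<sigma> xs) = mset xs" using \<sigma> by simp
    have "sum_list (map weight (permute_list \<sigma> xs)) = W"
      unfolding W_def by (metis ms mset_map sum_mset_sum_list)
    moreover have "\<forall>x\<in>set (permute_list \<sigma> xs). 1/3 < x"
      using xs(1) mset_eq_setD[OF ms] by simp
    ultimately have "2 * BF (permute_list \<sigma> xs) + (\<Sum>i\<in>?I. cell_matches b c \<sigma> i) \<le> 1 + W"
      using BF_matchable matchable_cells[OF \<sigma> b(1) c(1)] by metis
    then have "real (2 * BF (permute_list \<sigma> xs) + (\<Sum>i\<in>?I. cell_matches b c \<sigma> i)) \<le> real (1 + W)"
      by (rule of_nat_mono)
    then show ?thesis by (simp add: permute_list_def)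
  qed
  have "k - 2 * real ?n / T - 2 * real T - 2 * real T * sqrt ?n
      \<le> (real T - 1)\<^sup>2 * (real c * b / ?n - 2 * (sqrt ?n / T))"
    using T n bc le_length by (intro cell_estimate) auto
  also have "\<dots> = card ?I * (real c * b / ?n - 2 * d)"
    using T by (simp add: d_def of_nat_diff power2_eq_square)
  finally have "fact ?n * (k - 2 * real ?n / T - 2 * real T - 2 * real T * sqrt ?n)
      \<le> fact ?n * (card ?I * (real c * b / ?n - 2 * d))"
    by (rule mult_left_mono) simp
  also have "\<dots> = (\<Sum>i\<in>?I. fact ?n * (real c * b / ?n - 2 * d))" by simp
  also have "\<dots> \<le> (\<Sum>i\<in>?I. \<Sum>\<sigma> | \<sigma> permutes {..<?n}. real (cell_matches b c \<sigma> i))"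
  proof (rule sum_mono)
    fix i assume "i \<in> ?I"
    then obtain j t where "i = (j, t)" "j < T - 1" "t < T - 1" by auto
    then show "fact ?n * (real c * b / ?n - 2 * d)
        \<le> (\<Sum>\<sigma> | \<sigma> permutes {..<?n}. real (cell_matches b c \<sigma> i))"
      using sum_cell_matches_ge[OF n b(1) c(1) d0 d2] by simp
  qed
  also have "\<dots> = (\<Sum>\<sigma> | \<sigma> permutes {..<?n}. \<Sum>i\<in>?I. real (cell_matches b c \<sigma> i))"
    by (rule sum.swap)
  finally have cells: "fact ?n * (k - 2 * real ?n / T - 2 * real T - 2 * real T * sqrt ?n)
      \<le> (\<Sum>\<sigma> | \<sigma> permutes {..<?n}. \<Sum>i\<in>?I. real (cell_matches b c \<sigma> i))" .
  have "2 * (\<Sum>\<sigma> | \<sigma> permutes {..<?n}. real (BF (map (\<lambda>i. xs ! \<sigma> i) [0..<?n])))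
      \<le> (\<Sum>\<sigma> | \<sigma> permutes {..<?n}. 1 + W - (\<Sum>i\<in>?I. real (cell_matches b c \<sigma> i)))"
    unfolding sum_distrib_left using BF by (intro sum_mono) simp
  also have "\<dots> = fact ?n * (1 + real W) - (\<Sum>\<sigma> | \<sigma> permutes {..<?n}. \<Sum>i\<in>?I. real (cell_matches b c \<sigma> i))"
    unfolding sum_subtractf by (simp add: card_permutations)
  also have "\<dots> \<le> fact ?n * (1 + real W - (k - 2 * real ?n / T - 2 * real T - 2 * real T * sqrt ?n))"
    using cells by (simp add: right_diff_distrib)
  finally show ?thesis
    unfolding exp_BF_def W_def by (simp add: divide_le_eq mult.commute)
qed

text \<open>The number \<open>card P\<close> of mixed optimal bins enters the weight bound and the
  matching bound with opposite signs and cancels. The errors are then expressed by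
  \<open>Opt xs\<close>, as there are at most \<open>2 * Opt xs\<close> items.\<close>

lemma exp_BF_le:
  fixes T :: nat
  assumes xs: "\<forall>x\<in>set xs. 1/3 < x \<and> x \<le> 1" "xs \<noteq> []" and T: "1 \<le> T"
  shows "exp_BF xs \<le> Opt xs + 1/2 + 2 * real (Opt xs) / T + T + T * sqrt (2 * Opt xs)"
proof -
  obtain P where P: "\<And>l m. (l, m) \<in> P \<Longrightarrow>
      l < length xs \<and> m < length xs \<and> 1/2 < xs ! l \<and> xs ! m \<le> 1/2 \<and> xs ! l + xs ! m \<le> 1"
    "inj_on fst P" "inj_on snd P"
    "sum_list (map weight xs) \<le> 2 * Opt xs + card P" "length xs \<le> 2 * Opt xs"
    using Opt_pairs[OF xs(1)] by blast
  obtain l m where "sorted_pairs xs (card P) l m"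
    using sorted_pairs_exist[OF P(1-3)] by blast
  then have 1: "2 * exp_BF xs \<le> 1 + real (sum_list (map weight xs))
      - (card P - 2 * real (length xs) / T - 2 * real T - 2 * real T * sqrt (length xs))"
    using xs T by (intro sorted_pairs.exp_BF_le_weight) auto
  have 2: "real (sum_list (map weight xs)) \<le> 2 * real (Opt xs) + card P"
    using P(4) by linarith
  have 3: "real (length xs) \<le> 2 * real (Opt xs)" using P(5) by linarith
  then have 4: "2 * real (length xs) / T \<le> 2 * (2 * real (Opt xs)) / T"
    by (intro divide_right_mono) auto
  have "T * sqrt (length xs) \<le> T * sqrt (2 * Opt xs)"
    using 3 by (intro mult_left_mono) auto
  with 1 2 4 show ?thesis by simp
qed

section \<open>Unit items as the lower bound, and the limit\<close>

text \<open>Two unit items overflow a bin, so a packing is an injective map. Such lists have ratio 1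
  for every positive \<open>m\<close>; the case of no items also gives
  \<open>Opt [] = 0\<close>.\<close>

lemma Opt_replicate_1: "Opt (replicate m 1) = m"
proof (rule antisym)
  let ?xs = "replicate m (1::real)"
  obtain f where f: "\<And>i. i < length ?xs \<Longrightarrow> f i < Opt ?xs"
    "\<And>j. j < Opt ?xs \<Longrightarrow> (\<Sum>i | i < length ?xs \<and> f i = j. ?xs ! i) \<le> 1"
    "Opt ?xs \<le> length ?xs"
    by (rule Opt_packing[of ?xs]) (auto simp del: length_replicate)
  show "Opt ?xs \<le> m" using f(3) by simp
  have "inj_on f {..<m}"
  proof (rule inj_onI, rule ccontr)
    fix a b assume ab: "a \<in> {..<m}" "b \<in> {..<m}" "f a = f b" "a \<noteq> b"
    have "card {a, b} \<le> card {i. i < m \<and> f i = f a}"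
      using ab by (intro card_mono) auto
    moreover have "(\<Sum>i | i < m \<and> f i = f a. ?xs ! i) = card {i. i < m \<and> f i = f a}"
      by simp
    ultimately show False using f(2)[of "f a"] f(1)[of a] ab by simp
  qed
  then have "card {..<m} \<le> card {..<Opt ?xs}"
    using f(1) by (intro card_inj_on_le[of f]) auto
  then show "m \<le> Opt ?xs" by simp
qed

lemma BF_replicate_1: "BF (replicate m 1) = m"
proof -
  \<comment> \<open>The induction needs an arbitrary number \<open>i\<close> of bins that are
    already full.\<close>
  have "fold (\<lambda>x ls. bf_step ls x) (replicate m 1) (replicate i 1) = replicate (i + m) 1" for i
  proof (induction m arbitrary: i)
    case (Suc m)
    have "bf_step (replicate i 1) 1 = replicate (Suc i) 1"
      by (auto simp: bf_step_def replicate_append_same)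
    then show ?case using Suc[of "Suc i"] by simp
  qed simp
  from this[of 0] show ?thesis by (simp add: BF_def bf_pack_def)
qed

lemma exp_BF_replicate_1: "exp_BF (replicate m 1) = m"
proof -
  have "map (\<lambda>i. replicate m (1::real) ! \<sigma> i) [0..<m] = replicate m 1"
    if "\<sigma> permutes {..<m}" for \<sigma>
    using permutes_in_image[OF that] by (intro nth_equalityI) auto
  then show ?thesis
    by (simp add: exp_BF_def BF_replicate_1 card_permutations)
qed

theorem theorem1p3:
  shows "limsup (\<lambda>m::nat. SUP I \<in> {I :: real list. Opt I = m \<and> (\<forall>x\<in>set I. 1/3 < x \<and> x \<le> 1)}.
            ereal (exp_BF I / real (Opt I))) = 1"
proof (rule antisym)
  let ?S = "\<lambda>m. {I :: real list. Opt I = m \<and> (\<forall>x\<in>set I. 1/3 < x \<and> x \<le> 1)}"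
  show "limsup (\<lambda>m. SUP I \<in> ?S m. ereal (exp_BF I / real (Opt I))) \<le> 1"
  proof (rule ereal_le_epsilon2)
    fix \<epsilon> :: real assume \<epsilon>: "0 < \<epsilon>"
    \<comment> \<open>\<open>T\<close> is fixed before \<open>m\<close> grows: it brings the linear
      error \<open>2 / T\<close> below half of \<open>\<epsilon>\<close>, and the other errors are
      of order \<open>sqrt m\<close> for fixed \<open>T\<close>, hence vanish after division by
      \<open>m\<close>.\<close>
    obtain T :: nat where T: "4 / \<epsilon> < T" using reals_Archimedean2 by blast
    have "0 < 4 / \<epsilon>" using \<epsilon> by simp
    then have T1: "1 \<le> T" using T by linarith
    have T2: "2 / T \<le> \<epsilon> / 2" using T \<epsilon> T1 by (simp add: field_simps)
    have "((\<lambda>m::nat. (1/2 + real T + real T * sqrt (2 * real m)) / real m) \<longlongrightarrow> 0) at_top"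
      by real_asymp
    then have "\<forall>\<^sub>F m in sequentially. (1/2 + real T + real T * sqrt (2 * real m)) / real m < \<epsilon> / 2"
      using \<epsilon> by (intro order_tendstoD) auto
    then have "\<forall>\<^sub>F m in sequentially. (SUP I \<in> ?S m. ereal (exp_BF I / real (Opt I))) \<le> 1 + ereal \<epsilon>"
      using eventually_gt_at_top[of 0]
    proof eventually_elim
      case (elim m)
      show ?case
      proof (rule SUP_least)
        fix I assume "I \<in> ?S m"
        then have I: "Opt I = m" "\<forall>x\<in>set I. 1/3 < x \<and> x \<le> 1" by auto
        \<comment> \<open>The empty list has optimum 0, while \<open>m\<close> is positive
          here.\<close>
        have "I \<noteq> []" using I(1) elim(2) Opt_replicate_1[of 0] by auto
        then have "exp_BF I \<le> m + 1/2 + 2 * real m / T + T + T * sqrt (2 * m)"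
          using exp_BF_le[OF I(2) _ T1] I(1) by simp
        then have "exp_BF I / m \<le> (m + 1/2 + 2 * real m / T + T + T * sqrt (2 * m)) / m"
          by (intro divide_right_mono) auto
        also have "\<dots> = 1 + 2 / T + (1/2 + real T + real T * sqrt (2 * real m)) / real m"
          using elim(2) by (simp add: add_divide_distrib)
        also have "\<dots> \<le> 1 + \<epsilon>" using T2 elim(1) by linarith
        finally show "ereal (exp_BF I / real (Opt I)) \<le> 1 + ereal \<epsilon>"
          using I(1) by (simp add: one_ereal_def)
      qed
    qed
    then show "limsup (\<lambda>m. SUP I \<in> ?S m. ereal (exp_BF I / real (Opt I))) \<le> 1 + ereal \<epsilon>"
      by (rule Limsup_bounded)
  qed
  \<comment> \<open>The list of \<open>m\<close> unit items witnesses the lower bound;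
    \<open>m = 0\<close> is excluded because there the quotient is 0.\<close>
  have "\<forall>\<^sub>F m in sequentially. 1 \<le> (SUP I \<in> ?S m. ereal (exp_BF I / real (Opt I)))"
    using eventually_gt_at_top[of 0]
  proof eventually_elim
    case (elim m)
    show ?case
      by (rule SUP_upper2[of "replicate m 1"])
        (use elim in \<open>auto simp: Opt_replicate_1 exp_BF_replicate_1\<close>)
  qed
  then show "1 \<le> limsup (\<lambda>m. SUP I \<in> ?S m. ereal (exp_BF I / real (Opt I)))"
    by (intro le_Limsup) auto
qed

end
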